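(* The Banach space $\mathrm{Lip}_0(\mathbb{Z}_{\ell_1})$ is linearly isomorphic to $\mathrm{Lip}_0(\ell_1)$.
   Context: $\ell_1$ is the real Banach space of absolutely summable sequences with its standard basis $(e_n)_{n\in\mathbb{N}}$. The integer grid $\mathbb{Z}_{\ell_1}$ is the set of all finite linear combinations $\sum_{n=1}^N a_ne_n$ with $N\in\mathbb{N}$ and $a_n\in\mathbb{Z}$ for all $n$, equipped with the metric induced by the $\ell_1$-norm. For a metric space $M$ with a chosen base point $0\in M$, $\mathrm{Lip}_0(M)$ is the Banach space of Lipschitz functions $f:M\to\mathbb{R}$ with $f(0)=0$, normed by the best Lipschitz constant. *)

theory Defs
  imports "HOL-Analysis.Analysis"
begin

section \<open>The sequence space \<open>\<ell>\<^sub>1\<close>\<close>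

typedef l1 = "{x :: nat \<Rightarrow> real. summable (\<lambda>n. \<bar>x n\<bar>)}"
  morphisms l1_nth Abs_l1
  by (rule exI[of _ "\<lambda>_. 0"]) simp

setup_lifting type_definition_l1

lemma summable_abs_l1_nth: "summable (\<lambda>n. \<bar>l1_nth x n\<bar>)"
  using l1_nth[of x] by simp

lemma l1_eqI: "(\<And>n. l1_nth x n = l1_nth y n) \<Longrightarrow> x = y"
  by (metis ext l1_nth_inject)

instantiation l1 :: real_normed_vector
begin

lift_definition zero_l1 :: l1 is "\<lambda>_. 0" by simp

lift_definition plus_l1 :: "l1 \<Rightarrow> l1 \<Rightarrow> l1" is "\<lambda>x y n. x n + y n"
  subgoal for x y
    by (rule summable_comparison_test'[OF summable_add[of "\<lambda>n. \<bar>x n\<bar>" "\<lambda>n. \<bar>y n\<bar>"]]) auto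
  done

lift_definition uminus_l1 :: "l1 \<Rightarrow> l1" is "\<lambda>x n. - x n"
  by simp

lift_definition minus_l1 :: "l1 \<Rightarrow> l1 \<Rightarrow> l1" is "\<lambda>x y n. x n - y n"
  subgoal for x y
    by (rule summable_comparison_test'[OF summable_add[of "\<lambda>n. \<bar>x n\<bar>" "\<lambda>n. \<bar>y n\<bar>"]]) auto
  done

lift_definition scaleR_l1 :: "real \<Rightarrow> l1 \<Rightarrow> l1" is "\<lambda>c x n. c * x n"
  by (simp add: abs_mult summable_mult)

lift_definition norm_l1 :: "l1 \<Rightarrow> real" is "\<lambda>x. \<Sum>n. \<bar>x n\<bar>" .

definition dist_l1 :: "l1 \<Rightarrow> l1 \<Rightarrow> real"
  where "dist_l1 x y = norm (x - y)"

definition uniformity_l1 :: "(l1 \<times> l1) filter"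
  where "uniformity_l1 = (INF e\<in>{0 <..}. principal {(x, y). dist x y < e})"

definition open_l1 :: "l1 set \<Rightarrow> bool"
  where "open_l1 U = (\<forall>x\<in>U. \<forall>\<^sub>F (x', y) in uniformity. x' = x \<longrightarrow> y \<in> U)"

definition sgn_l1 :: "l1 \<Rightarrow> l1"
  where "sgn_l1 x = inverse (norm x) *\<^sub>R x"

instance
proof
  fix x y z :: l1 and a b :: real
  show "x + y + z = x + (y + z)" "x + y = y + x" "0 + x = x" "- x + x = 0" "x - y = x + - y"
    "a *\<^sub>R (x + y) = a *\<^sub>R x + a *\<^sub>R y" "(a + b) *\<^sub>R x = a *\<^sub>R x + b *\<^sub>R x"
    "a *\<^sub>R b *\<^sub>R x = (a * b) *\<^sub>R x" "1 *\<^sub>R x = x"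
    by (transfer; simp add: algebra_simps fun_eq_iff)+
  show "dist x y = norm (x - y)" by (fact dist_l1_def)
  show "sgn x = inverse (norm x) *\<^sub>R x" by (fact sgn_l1_def)
  show "(uniformity :: (l1 \<times> l1) filter) = (INF e\<in>{0 <..}. principal {(x, y). dist x y < e})"
    by (fact uniformity_l1_def)
  show "open U = (\<forall>x\<in>U. \<forall>\<^sub>F (x', y) in uniformity. x' = x \<longrightarrow> y \<in> U)" for U :: "l1 set"
    by (fact open_l1_def)
  show "(norm x = 0) = (x = 0)"
    by transfer (auto simp: suminf_eq_zero_iff fun_eq_iff)
  show "norm (x + y) \<le> norm x + norm y"
  proof transfer
    fix x y :: "nat \<Rightarrow> real"
    assume s: "summable (\<lambda>n. \<bar>x n\<bar>)" "summable (\<lambda>n. \<bar>y n\<bar>)"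
    have "summable (\<lambda>n. \<bar>x n + y n\<bar>)"
      by (rule summable_comparison_test'[OF summable_add[OF s]]) auto
    then have "(\<Sum>n. \<bar>x n + y n\<bar>) \<le> (\<Sum>n. \<bar>x n\<bar> + \<bar>y n\<bar>)"
      by (intro suminf_le summable_add s) auto
    then show "(\<Sum>n. \<bar>x n + y n\<bar>) \<le> (\<Sum>n. \<bar>x n\<bar>) + (\<Sum>n. \<bar>y n\<bar>)"
      by (simp add: suminf_add s)
  qed
  show "norm (a *\<^sub>R x) = \<bar>a\<bar> * norm x"
    by transfer (simp add: abs_mult suminf_mult)
qed

end

lemma norm_l1_sum_le: "(\<Sum>n<N. \<bar>l1_nth x n\<bar>) \<le> norm x"
  unfolding norm_l1.rep_eq by (intro sum_le_suminf summable_abs_l1_nth) auto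

lemma norm_l1_leI:
  assumes "\<And>N. (\<Sum>n<N. \<bar>l1_nth x n\<bar>) \<le> B"
  shows "norm x \<le> B"
  unfolding norm_l1.rep_eq by (rule suminf_le_const[OF summable_abs_l1_nth assms])

instance l1 :: banach
proof
  fix X :: "nat \<Rightarrow> l1"
  assume C: "Cauchy X"
  have nth: "\<bar>l1_nth x n\<bar> \<le> norm x" for x n
  proof -
    have "\<bar>l1_nth x n\<bar> \<le> (\<Sum>k<Suc n. \<bar>l1_nth x k\<bar>)" by (simp add: sum_nonneg)
    also have "\<dots> \<le> norm x"
      by (rule norm_l1_sum_le)
    finally show ?thesis .
  qed
  have "Cauchy (\<lambda>k. l1_nth (X k) n)" for n
  proof (rule CauchyI)
    fix e :: real assume "e > 0"
    then obtain M where "\<forall>j\<ge>M. \<forall>k\<ge>M. norm (X j - X k) < e"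
      using CauchyD[OF C] by metis
    then show "\<exists>M. \<forall>j\<ge>M. \<forall>k\<ge>M. norm (l1_nth (X j) n - l1_nth (X k) n) < e"
      by (metis nth minus_l1.rep_eq le_less_trans real_norm_def)
  qed
  then have "\<forall>n. \<exists>l. (\<lambda>k. l1_nth (X k) n) \<longlonglongrightarrow> l"
    by (simp add: Cauchy_convergent_iff convergent_def)
  then obtain x where x: "\<And>n. (\<lambda>k. l1_nth (X k) n) \<longlonglongrightarrow> x n" by metis
  have bound: "(\<Sum>n<N. \<bar>l1_nth (X j) n - x n\<bar>) \<le> e"
    if M: "\<And>k. k \<ge> M \<Longrightarrow> norm (X j - X k) < e" for M j e N
  proof (rule tendsto_upperbound)
    show "(\<lambda>k. \<Sum>n<N. \<bar>l1_nth (X j) n - l1_nth (X k) n\<bar>) \<longlonglongrightarrow> (\<Sum>n<N. \<bar>l1_nth (X j) n - x n\<bar>)"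
      by (intro tendsto_intros x)
    show "\<forall>\<^sub>F k in sequentially. (\<Sum>n<N. \<bar>l1_nth (X j) n - l1_nth (X k) n\<bar>) \<le> e"
    proof (rule eventually_sequentiallyI)
      fix k assume "M \<le> k"
      then show "(\<Sum>n<N. \<bar>l1_nth (X j) n - l1_nth (X k) n\<bar>) \<le> e"
        using norm_l1_sum_le[where N=N and x="X j - X k"] M[of k]
        by (simp add: minus_l1.rep_eq)
    qed
  qed simp
  obtain M1 where "\<And>j k. j \<ge> M1 \<Longrightarrow> k \<ge> M1 \<Longrightarrow> norm (X j - X k) < 1"
    using CauchyD[OF C, of 1] by auto
  then have "(\<Sum>n<N. \<bar>l1_nth (X M1) n - x n\<bar>) \<le> 1" for N
    by (intro bound) auto
  then have "summable (\<lambda>n. \<bar>l1_nth (X M1) n - x n\<bar>)"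
    by (intro bounded_imp_summable[where B=1]) (simp_all flip: lessThan_Suc_atMost del: sum.lessThan_Suc)
  then have "summable (\<lambda>n. \<bar>l1_nth (X M1) n\<bar> + \<bar>l1_nth (X M1) n - x n\<bar>)"
    by (intro summable_add summable_abs_l1_nth)
  then have "summable (\<lambda>n. \<bar>x n\<bar>)"
    by (rule summable_comparison_test') auto
  then have x_eq: "l1_nth (Abs_l1 x) = x" by (simp add: Abs_l1_inverse)
  have "X \<longlonglongrightarrow> Abs_l1 x"
  proof (rule LIMSEQ_I)
    fix e :: real assume "e > 0"
    then obtain M where M: "\<And>j k. j \<ge> M \<Longrightarrow> k \<ge> M \<Longrightarrow> norm (X j - X k) < e / 2"
      using CauchyD[OF C, of "e / 2"] by auto
    have "norm (X j - Abs_l1 x) \<le> e / 2" if "j \<ge> M" for j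
      using bound[of M j "e / 2"] M[OF that] by (intro norm_l1_leI) (simp add: minus_l1.rep_eq x_eq)
    then show "\<exists>M. \<forall>j\<ge>M. norm (X j - Abs_l1 x) < e"
      using \<open>e > 0\<close> by (intro exI[of _ M]) force
  qed
  then show "convergent X" by (auto simp: convergent_def)
qed

lift_definition l1_basis :: "nat \<Rightarrow> l1" is "\<lambda>n k. if k = n then 1 else 0"
proof -
  show "summable (\<lambda>k. \<bar>if k = n then 1 else 0 :: real\<bar>)" for n :: nat
    by (rule summable_finite[of "{n}"]) auto
qed


section \<open>The integer grid of \<open>\<ell>\<^sub>1\<close>\<close>

text \<open>Coordinates and basis vectors are indexed from \<open>0\<close>. The grid is not a linear subspace, so it
  only carries the metric induced by \<^typ>\<open>l1\<close> and its zero.\<close>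

typedef l1_grid =
  "{x. \<exists>N :: nat. \<exists>a :: nat \<Rightarrow> int. x = (\<Sum>n<N. of_int (a n) *\<^sub>R l1_basis n)}"
  morphisms l1_of_grid Abs_l1_grid
  by (rule exI[of _ 0]) (auto intro: exI[of _ "0 :: nat"])

setup_lifting type_definition_l1_grid

instantiation l1_grid :: "{metric_space, zero}"
begin

lift_definition zero_l1_grid :: l1_grid is 0
  by (auto intro: exI[of _ "0 :: nat"])

definition dist_l1_grid :: "l1_grid \<Rightarrow> l1_grid \<Rightarrow> real"
  where "dist_l1_grid x y = dist (l1_of_grid x) (l1_of_grid y)"

definition uniformity_l1_grid :: "(l1_grid \<times> l1_grid) filter"
  where "uniformity_l1_grid = (INF e\<in>{0 <..}. principal {(x, y). dist x y < e})"

definition open_l1_grid :: "l1_grid set \<Rightarrow> bool"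
  where "open_l1_grid U = (\<forall>x\<in>U. \<forall>\<^sub>F (x', y) in uniformity. x' = x \<longrightarrow> y \<in> U)"

instance
proof
  fix x y z :: l1_grid
  show "(dist x y = 0) = (x = y)"
    by (simp add: dist_l1_grid_def l1_of_grid_inject)
  show "dist x y \<le> dist x z + dist y z"
    by (simp add: dist_l1_grid_def dist_triangle2)
  show "(uniformity :: (l1_grid \<times> l1_grid) filter) =
      (INF e\<in>{0 <..}. principal {(x, y). dist x y < e})"
    by (fact uniformity_l1_grid_def)
  show "open U = (\<forall>x\<in>U. \<forall>\<^sub>F (x', y) in uniformity. x' = x \<longrightarrow> y \<in> U)" for U :: "l1_grid set"
    by (fact open_l1_grid_def)
qed

end


section \<open>Spaces of Lipschitz functions vanishing at the base point\<close>

text \<open>The base point of the metric space \<^typ>\<open>'a\<close> is the constant \<open>0\<close>; no algebraic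
  property of it is assumed.\<close>

typedef (overloaded) 'a lip0 =
  "{f :: 'a :: {metric_space, zero} \<Rightarrow> real. f 0 = 0 \<and> (\<exists>L. L-lipschitz_on UNIV f)}"
  morphisms lip0_apply Abs_lip0
  by (rule exI[of _ "\<lambda>_. 0"]) (auto intro!: exI[of _ 0] lipschitz_onI)

setup_lifting type_definition_lip0

lemma lip0_eqI: "(\<And>x. lip0_apply f x = lip0_apply g x) \<Longrightarrow> f = g"
  by (metis ext lip0_apply_inject)

lemma lip0_apply_0: "lip0_apply f 0 = 0"
  using lip0_apply[of f] by simp

instantiation lip0 :: ("{metric_space, zero}") real_normed_vector
begin

lift_definition zero_lip0 :: "'a lip0" is "\<lambda>_. 0"
  by (auto intro!: exI[of _ 0] lipschitz_onI)

lift_definition plus_lip0 :: "'a lip0 \<Rightarrow> 'a lip0 \<Rightarrow> 'a lip0" is "\<lambda>f g x. f x + g x"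
  by (auto intro: lipschitz_on_add)

lift_definition uminus_lip0 :: "'a lip0 \<Rightarrow> 'a lip0" is "\<lambda>f x. - f x"
  by (auto intro: lipschitz_on_minus)

lift_definition minus_lip0 :: "'a lip0 \<Rightarrow> 'a lip0 \<Rightarrow> 'a lip0" is "\<lambda>f g x. f x - g x"
  by (auto intro: lipschitz_on_diff)

lift_definition scaleR_lip0 :: "real \<Rightarrow> 'a lip0 \<Rightarrow> 'a lip0" is "\<lambda>c f x. c * f x"
  by (auto intro: lipschitz_on_cmult_real)

lift_definition norm_lip0 :: "'a lip0 \<Rightarrow> real" is "\<lambda>f. Inf {L. L-lipschitz_on UNIV f}" .

definition dist_lip0 :: "'a lip0 \<Rightarrow> 'a lip0 \<Rightarrow> real"
  where "dist_lip0 f g = norm (f - g)"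

definition uniformity_lip0 :: "('a lip0 \<times> 'a lip0) filter"
  where "uniformity_lip0 = (INF e\<in>{0 <..}. principal {(x, y). dist x y < e})"

definition open_lip0 :: "'a lip0 set \<Rightarrow> bool"
  where "open_lip0 U = (\<forall>x\<in>U. \<forall>\<^sub>F (x', y) in uniformity. x' = x \<longrightarrow> y \<in> U)"

definition sgn_lip0 :: "'a lip0 \<Rightarrow> 'a lip0"
  where "sgn_lip0 f = inverse (norm f) *\<^sub>R f"

lemma norm_lip0_le: "L-lipschitz_on UNIV (lip0_apply f) \<Longrightarrow> norm f \<le> L"
  unfolding norm_lip0.rep_eq
  by (rule cInf_lower) (auto intro!: bdd_belowI[of _ 0] lipschitz_on_nonneg)

lemma lipschitz_on_norm_lip0: "(norm f)-lipschitz_on UNIV (lip0_apply f)"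
proof -
  let ?S = "{L. L-lipschitz_on UNIV (lip0_apply f)}"
  have ne: "?S \<noteq> {}" using lip0_apply[of f] by auto
  show ?thesis
  proof (rule lipschitz_onI)
    show "0 \<le> norm f"
      unfolding norm_lip0.rep_eq by (rule cInf_greatest[OF ne]) (auto intro: lipschitz_on_nonneg)
    fix x y
    show "dist (lip0_apply f x) (lip0_apply f y) \<le> norm f * dist x y"
    proof (cases "x = y")
      case False
      then have "dist (lip0_apply f x) (lip0_apply f y) / dist x y \<le> norm f"
        unfolding norm_lip0.rep_eq
        by (intro cInf_greatest[OF ne]) (auto simp: divide_le_eq dest: lipschitz_onD)
      with False show ?thesis by (simp add: divide_le_eq)
    qed simp
  qed
qed

lemma norm_lip0_nonneg: "norm (f :: 'a lip0) \<ge> 0"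
  by (rule lipschitz_on_nonneg[OF lipschitz_on_norm_lip0])

instance
proof
  fix f g h :: "'a lip0" and a b :: real
  show "f + g + h = f + (g + h)" "f + g = g + f" "0 + f = f" "- f + f = 0" "f - g = f + - g"
    "a *\<^sub>R (f + g) = a *\<^sub>R f + a *\<^sub>R g" "(a + b) *\<^sub>R f = a *\<^sub>R f + b *\<^sub>R f"
    "a *\<^sub>R b *\<^sub>R f = (a * b) *\<^sub>R f" "1 *\<^sub>R f = f"
    by (transfer; simp add: algebra_simps fun_eq_iff)+
  show "dist f g = norm (f - g)" by (fact dist_lip0_def)
  show "sgn f = inverse (norm f) *\<^sub>R f" by (fact sgn_lip0_def)
  show "(uniformity :: ('a lip0 \<times> 'a lip0) filter) =
      (INF e\<in>{0 <..}. principal {(x, y). dist x y < e})"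
    by (fact uniformity_lip0_def)
  show "open U = (\<forall>x\<in>U. \<forall>\<^sub>F (x', y) in uniformity. x' = x \<longrightarrow> y \<in> U)" for U :: "'a lip0 set"
    by (fact open_lip0_def)
  show "(norm f = 0) = (f = 0)"
  proof
    assume "norm f = 0"
    then have "lip0_apply f x = 0" for x
      using lipschitz_onD[OF lipschitz_on_norm_lip0[of f], of x 0] by (simp add: lip0_apply_0)
    then show "f = 0" by (intro lip0_eqI) (simp add: zero_lip0.rep_eq)
  next
    assume "f = 0"
    then have "norm f \<le> 0"
      by (intro norm_lip0_le lipschitz_onI) (auto simp: zero_lip0.rep_eq)
    then show "norm f = 0" using norm_lip0_nonneg[of f] by simp
  qed
  show "norm (f + g) \<le> norm f + norm g"
    by (rule norm_lip0_le) (simp add: plus_lip0.rep_eq lipschitz_on_add lipschitz_on_norm_lip0)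
  have le: "norm (c *\<^sub>R k) \<le> \<bar>c\<bar> * norm k" for c and k :: "'a lip0"
    by (rule norm_lip0_le)
      (simp add: scaleR_lip0.rep_eq lipschitz_on_cmult_real lipschitz_on_norm_lip0)
  show "norm (a *\<^sub>R f) = \<bar>a\<bar> * norm f"
  proof (cases "a = 0")
    case True
    then show ?thesis using le[of a f] norm_lip0_nonneg[of "a *\<^sub>R f"] by simp
  next
    case False
    have "inverse a *\<^sub>R a *\<^sub>R f = f"
      using False by (intro lip0_eqI) (simp add: scaleR_lip0.rep_eq)
    then have "norm f \<le> \<bar>inverse a\<bar> * norm (a *\<^sub>R f)"
      using le[of "inverse a" "a *\<^sub>R f"] by simp
    with False have "\<bar>a\<bar> * norm f \<le> norm (a *\<^sub>R f)"
      by (simp add: field_simps)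
    with le[of a f] show ?thesis by simp
  qed
qed

end

instance lip0 :: ("{metric_space, zero}") banach
proof
  fix F :: "nat \<Rightarrow> 'a lip0"
  assume C: "Cauchy F"
  have diff: "\<bar>(lip0_apply f x - lip0_apply g x) - (lip0_apply f y - lip0_apply g y)\<bar>
      \<le> norm (f - g) * dist x y" for f g :: "'a lip0" and x y
    using lipschitz_onD[OF lipschitz_on_norm_lip0[of "f - g"], of x y]
    by (simp add: minus_lip0.rep_eq dist_real_def)
  have "Cauchy (\<lambda>k. lip0_apply (F k) x)" for x
  proof (rule CauchyI)
    fix e :: real assume "e > 0"
    define d where "d = e / (dist x 0 + 1)"
    have "dist x 0 + 1 > 0" by (simp add: add_nonneg_pos)
    with \<open>e > 0\<close> have "d > 0" by (simp add: d_def)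
    then obtain M where M: "\<And>j k. j \<ge> M \<Longrightarrow> k \<ge> M \<Longrightarrow> norm (F j - F k) < d"
      using CauchyD[OF C] by metis
    have "norm (lip0_apply (F j) x - lip0_apply (F k) x) < e" if "j \<ge> M" "k \<ge> M" for j k
    proof -
      have "\<bar>lip0_apply (F j) x - lip0_apply (F k) x\<bar> \<le> norm (F j - F k) * dist x 0"
        using diff[of "F j" x "F k" 0] by (simp add: lip0_apply_0)
      also have "\<dots> \<le> d * dist x 0"
        using M[OF that] by (intro mult_right_mono) auto
      also have "\<dots> < d * (dist x 0 + 1)"
        using \<open>d > 0\<close> by simp
      also have "\<dots> = e" using \<open>dist x 0 + 1 > 0\<close> by (simp add: d_def)
      finally show ?thesis by simp
    qed
    then show "\<exists>M. \<forall>j\<ge>M. \<forall>k\<ge>M. norm (lip0_apply (F j) x - lip0_apply (F k) x) < e"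
      by blast
  qed
  then have "\<forall>x. \<exists>l. (\<lambda>k. lip0_apply (F k) x) \<longlonglongrightarrow> l"
    by (simp add: Cauchy_convergent_iff convergent_def)
  then obtain f where f: "\<And>x. (\<lambda>k. lip0_apply (F k) x) \<longlonglongrightarrow> f x" by metis
  have bound: "e-lipschitz_on UNIV (\<lambda>x. lip0_apply (F j) x - f x)"
    if "e > 0" and M: "\<And>k. k \<ge> M \<Longrightarrow> norm (F j - F k) < e" for M j e
  proof (rule lipschitz_onI)
    fix x y
    have "\<bar>(lip0_apply (F j) x - f x) - (lip0_apply (F j) y - f y)\<bar> \<le> e * dist x y"
    proof (rule tendsto_upperbound)
      show "(\<lambda>k. \<bar>(lip0_apply (F j) x - lip0_apply (F k) x)
          - (lip0_apply (F j) y - lip0_apply (F k) y)\<bar>)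
        \<longlonglongrightarrow> \<bar>(lip0_apply (F j) x - f x) - (lip0_apply (F j) y - f y)\<bar>"
        by (intro tendsto_intros f)
      show "\<forall>\<^sub>F k in sequentially. \<bar>(lip0_apply (F j) x - lip0_apply (F k) x)
          - (lip0_apply (F j) y - lip0_apply (F k) y)\<bar> \<le> e * dist x y"
        by (rule eventually_sequentiallyI[of M])
          (rule order_trans[OF diff], auto intro!: mult_right_mono less_imp_le[OF M])
    qed simp
    then show "dist (lip0_apply (F j) x - f x) (lip0_apply (F j) y - f y) \<le> e * dist x y"
      by (simp add: dist_real_def)
  qed (use \<open>e > 0\<close> in simp)
  obtain M1 where "\<And>j k. j \<ge> M1 \<Longrightarrow> k \<ge> M1 \<Longrightarrow> norm (F j - F k) < 1"
    using CauchyD[OF C, of 1] by auto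
  then have "1-lipschitz_on UNIV (\<lambda>x. lip0_apply (F M1) x - f x)"
    by (intro bound) auto
  from lipschitz_on_diff[OF lipschitz_on_norm_lip0[of "F M1"] this]
  have "\<exists>L. L-lipschitz_on UNIV f" by auto
  moreover have "f 0 = 0"
    using f[of 0] by (simp add: lip0_apply_0 LIMSEQ_const_iff)
  ultimately have f_eq: "lip0_apply (Abs_lip0 f) = f" by (simp add: Abs_lip0_inverse)
  have "F \<longlonglongrightarrow> Abs_lip0 f"
  proof (rule LIMSEQ_I)
    fix e :: real assume "e > 0"
    then obtain M where M: "\<And>j k. j \<ge> M \<Longrightarrow> k \<ge> M \<Longrightarrow> norm (F j - F k) < e / 2"
      using CauchyD[OF C, of "e / 2"] by auto
    have "norm (F j - Abs_lip0 f) \<le> e / 2" if "j \<ge> M" for j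
      using \<open>e > 0\<close> bound[of "e / 2" M j] M[OF that]
      by (intro norm_lip0_le) (simp add: minus_lip0.rep_eq f_eq)
    then show "\<exists>M. \<forall>j\<ge>M. norm (F j - Abs_lip0 f) < e"
      using \<open>e > 0\<close> by (intro exI[of _ M]) force
  qed
  then show "convergent F" by (auto simp: convergent_def)
qed

end

theory Submission
  imports Defs
begin

text \<open>Let \<open>X = Lip\<^sub>0(\<ell>\<^sub>1)\<close>, \<open>Y = Lip\<^sub>0(\<int>\<^bsub>\<ell>\<^sub>1\<^esub>)\<close> and \<open>L = \<ell>\<^sub>\<infinity>(Y)\<close>, modelled as bounded functions on the
  discrete space of natural numbers. By Pelczynski's decomposition method it is enough that \<open>L\<close> is
  complemented in \<open>Y\<close>, \<open>Y\<close> in \<open>X\<close>, and \<open>X\<close> in \<open>L\<close>.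

  Partition the coordinates into infinitely many infinite blocks, with projections \<open>P\<^sub>k\<close> of the grid
  onto the blocks. Since the \<open>\<ell>\<^sub>1\<close>-norm is the sum of the norms over the blocks, \<open>\<Sum>\<^sub>k f\<^sub>k \<circ> P\<^sub>k\<close> is
  Lipschitz for bounded \<open>(f\<^sub>k)\<close>, which complements \<open>L\<close> in \<open>Y\<close>.

  A function \<open>f\<close> on \<open>\<ell>\<^sub>1\<close> is recovered from its rescaled restrictions \<open>m f(\<cdot>/m)\<close> to the grid, by
  taking the limit along an ultrafilter of the values at rounded points; this complements \<open>X\<close> in
  \<open>L\<close>. The same limit extends \<open>f\<close> from the grid to \<open>\<ell>\<^sub>1\<close>, once \<open>f\<close> is
  interpolated on \<open>1/m\<close> times the grid by \<open>1/m \<Sum>\<^sub>j\<^sub><\<^sub>m f(\<lfloor>x + j/m\<rfloor>)\<close>, the floor being taken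
  coordinatewise. The identity \<open>\<Sum>\<^sub>j\<^sub><\<^sub>m \<lfloor>(a + j)/m\<rfloor> = a\<close> for integers \<open>a\<close> makes the interpolation
  preserve the Lipschitz constant.\<close>

section \<open>Complemented subspaces and the decomposition method\<close>

text \<open>Applying \<open>p\<close> and then \<open>i\<close> is a bounded projection onto the
  range of \<open>i\<close>, so the first space is, up to isomorphism, a complemented subspace of
  the second.\<close>

definition retract_pair :: "('a::real_normed_vector \<Rightarrow> 'b::real_normed_vector) \<Rightarrow> ('b \<Rightarrow> 'a) \<Rightarrow> bool"
  where "retract_pair i p \<longleftrightarrow> bounded_linear i \<and> bounded_linear p \<and> (\<forall>x. p (i x) = x)"

definition iso_pair :: "('a::real_normed_vector \<Rightarrow> 'b::real_normed_vector) \<Rightarrow> ('b \<Rightarrow> 'a) \<Rightarrow> bool"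
  where "iso_pair f g \<longleftrightarrow> retract_pair f g \<and> retract_pair g f"

lemma retract_pair_trans:
  assumes "retract_pair i p" "retract_pair j q"
  shows "retract_pair (\<lambda>x. j (i x)) (\<lambda>y. p (q y))"
  using assms by (auto simp: retract_pair_def intro: bounded_linear_compose)

lemma iso_pair_trans:
  assumes "iso_pair f g" "iso_pair f' g'"
  shows "iso_pair (\<lambda>x. f' (f x)) (\<lambda>y. g (g' y))"
  using assms by (auto simp: iso_pair_def intro: retract_pair_trans)

lemma iso_pair_sym: "iso_pair f g \<Longrightarrow> iso_pair g f"
  by (simp add: iso_pair_def)

lemma bounded_linear_apply_bcontfun: "bounded_linear (\<lambda>f. apply_bcontfun f n)"
  by (rule bounded_linear_intro[where K = 1]) (auto intro: norm_bounded)

text \<open>Continuity is automatic on the discrete index space, so the common bound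
  \<open>K\<close> alone puts each sequence \<open>T n x\<close> into the target.\<close>

lemma bounded_linear_into_bcontfun:
  fixes T :: "nat \<Rightarrow> 'a::real_normed_vector \<Rightarrow> 'b::real_normed_vector"
  assumes lin: "\<And>n. bounded_linear (T n)" and bd: "\<And>n x. norm (T n x) \<le> K * norm x"
  shows "\<exists>S. bounded_linear S \<and> (\<forall>x n. apply_bcontfun (S x) n = T n x)"
proof (intro exI conjI allI)
  define S where "S x = Bcontfun (\<lambda>n. T n x)" for x
  have app: "apply_bcontfun (S x) n = T n x" for x n
    unfolding S_def
    by (subst Bcontfun_inverse) (auto intro!: bcontfun_normI[where b = "K * norm x"] bd)
  then show "apply_bcontfun (S x) n = T n x" for x n .
  show "bounded_linear S"
  proof (rule bounded_linear_intro[where K = K])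
    show "norm (S x) \<le> norm x * K" for x
      by (rule norm_bound) (simp add: app bd mult.commute)
  qed (auto intro!: bcontfun_eqI simp: app linear_simps[OF lin])
qed

text \<open>Since \<open>Y \<cong> F \<oplus> ker p\<close>, the summand \<open>F\<close> is absorbed by shifting the
  \<open>F\<close>-components of a sequence by one place.\<close>

lemma absorb_into_bcontfun:
  fixes i :: "'f::real_normed_vector \<Rightarrow> 'y::real_normed_vector"
  assumes "retract_pair i p"
  shows "\<exists>f g. iso_pair (f :: 'f \<times> (nat \<Rightarrow>\<^sub>C 'y) \<Rightarrow> (nat \<Rightarrow>\<^sub>C 'y)) g"
proof -
  have i: "bounded_linear i" and p: "bounded_linear p" and pi: "p (i x) = x" for x
    using assms by (auto simp: retract_pair_def)
  \<comment> \<open>\<open>e\<close> projects onto the copy of \<open>'f\<close> in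
    \<open>'y\<close>, and \<open>a\<close> onto the kernel of \<open>p\<close>.\<close>
  define e where "e y = i (p y)" for y
  define a where "a y = y - e y" for y
  have e: "bounded_linear e"
    unfolding e_def by (rule bounded_linear_compose[OF i p])
  have a: "bounded_linear a"
    unfolding a_def by (intro bounded_linear_sub bounded_linear_ident e)
  obtain Ki where Ki: "norm (i x) \<le> norm x * Ki" "0 \<le> Ki" for x
    using bounded_linear.nonneg_bounded[OF i] by metis
  obtain Ke where Ke: "norm (e x) \<le> norm x * Ke" "0 \<le> Ke" for x
    using bounded_linear.nonneg_bounded[OF e] by metis
  obtain Ka where Ka: "norm (a x) \<le> norm x * Ka" "0 \<le> Ka" for x
    using bounded_linear.nonneg_bounded[OF a] by metis
  \<comment> \<open>Right shift of the \<open>e\<close>-components, with the new vector entering at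
    index 0; the \<open>a\<close>-components stay in place.\<close>
  define T :: "nat \<Rightarrow> 'f \<times> (nat \<Rightarrow>\<^sub>C 'y) \<Rightarrow> 'y" where
    "T n z = (case n of 0 \<Rightarrow> i (fst z) | Suc k \<Rightarrow> e (apply_bcontfun (snd z) k)) +
      a (apply_bcontfun (snd z) n)" for n z
  have Tl: "bounded_linear (T n)" for n
    unfolding T_def
    by (cases n) (auto intro!: bounded_linear_add bounded_linear_compose[OF i bounded_linear_fst]
        bounded_linear_compose[OF e] bounded_linear_compose[OF a]
        bounded_linear_compose[OF bounded_linear_apply_bcontfun bounded_linear_snd])
  have Tb: "norm (T n z) \<le> (Ki + Ke + Ka) * norm z" for n z
  proof -
    have nz: "norm (apply_bcontfun (snd z) k) \<le> norm z" for k
      using norm_bounded[of "snd z" k] norm_snd_le[of "snd z" "fst z"] by simp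
    have fz: "norm (fst z) \<le> norm z"
      using norm_fst_le[of "fst z" "snd z"] by simp
    have 1: "norm (i (fst z)) \<le> norm z * Ki" 
      by (rule order_trans[OF Ki(1)]) (intro mult_right_mono fz Ki(2))
    have 2: "norm (e (apply_bcontfun (snd z) k)) \<le> norm z * Ke" for k
      by (rule order_trans[OF Ke(1)]) (intro mult_right_mono nz Ke(2))
    have 3: "norm (a (apply_bcontfun (snd z) k)) \<le> norm z * Ka" for k
      by (rule order_trans[OF Ka(1)]) (intro mult_right_mono nz Ka(2))
    have 4: "0 \<le> norm z * Ki" "0 \<le> norm z * Ke"
      using Ki(2) Ke(2) by auto
    have "norm (case n of 0 \<Rightarrow> i (fst z) | Suc k \<Rightarrow> e (apply_bcontfun (snd z) k))
        \<le> norm z * Ki + norm z * Ke"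
      using 1 2 4 by (cases n) (auto intro: add_increasing add_increasing2)
    then show ?thesis
      unfolding T_def
      using norm_triangle_mono[OF _ 3[of n]] by (fastforce simp: algebra_simps)
  qed
  obtain f where f: "bounded_linear f" "\<And>z n. apply_bcontfun (f z) n = T n z"
    using bounded_linear_into_bcontfun[of T, OF Tl Tb] by blast
  \<comment> \<open>The matching left shift. It drops the \<open>e\<close>-component at index 0,
    which \<open>g\<close> recovers through \<open>p\<close>.\<close>
  define T' :: "nat \<Rightarrow> (nat \<Rightarrow>\<^sub>C 'y) \<Rightarrow> 'y" where
    "T' n y = e (apply_bcontfun y (Suc n)) + a (apply_bcontfun y n)" for n y
  have Tl': "bounded_linear (T' n)" for n
    unfolding T'_def
    by (auto intro!: bounded_linear_add bounded_linear_compose[OF e] bounded_linear_compose[OF a]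
        bounded_linear_apply_bcontfun)
  have Tb': "norm (T' n y) \<le> (Ke + Ka) * norm y" for n y
  proof -
    have 2: "norm (e (apply_bcontfun y k)) \<le> norm y * Ke" for k
      by (rule order_trans[OF Ke(1)]) (intro mult_right_mono norm_bounded Ke(2))
    have 3: "norm (a (apply_bcontfun y k)) \<le> norm y * Ka" for k
      by (rule order_trans[OF Ka(1)]) (intro mult_right_mono norm_bounded Ka(2))
    show ?thesis
      unfolding T'_def
      by (rule order_trans[OF norm_triangle_ineq]) (use 2 3 in \<open>auto simp: algebra_simps intro: add_mono\<close>)
  qed
  obtain g' where g': "bounded_linear g'" "\<And>y n. apply_bcontfun (g' y) n = T' n y"
    using bounded_linear_into_bcontfun[of T', OF Tl' Tb'] by blast
  define g where "g y = (p (apply_bcontfun y 0), g' y)" for y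
  have g: "bounded_linear g"
    unfolding g_def
    by (intro bounded_linear_Pair g' bounded_linear_compose[OF p] bounded_linear_apply_bcontfun)
  have pa: "p (a y) = 0" and ee: "e (e y) = e y" and ea: "e (a y) = 0"
    and aa: "a (a y) = a y" and ae: "a (e y) = 0" and ai: "a (i x) = 0" and ei: "e (i x) = i x"
    and sum: "e y + a y = y" for x y
    by (simp_all add: a_def e_def linear_simps[OF p] linear_simps[OF i] pi)
  note rules = pa ee ea aa ae ai ei pi sum linear_simps(1)[OF p] linear_simps(1)[OF e]
    linear_simps(1)[OF a]
  have "g (f z) = z" for z
  proof (rule prod_eqI)
    show "fst (g (f z)) = fst z"
      by (simp add: g_def f T_def rules)
    show "snd (g (f z)) = snd z"
    proof (rule bcontfun_eqI)
      fix n
      show "apply_bcontfun (snd (g (f z))) n = apply_bcontfun (snd z) n"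
        by (cases n) (simp_all add: g_def f g' T_def T'_def rules)
    qed
  qed
  moreover have "f (g y) = y" for y
  proof (rule bcontfun_eqI)
    fix n
    show "apply_bcontfun (f (g y)) n = apply_bcontfun y n"
      by (cases n) (simp_all add: g_def f g' T_def T'_def rules flip: e_def)
  qed
  ultimately show ?thesis
    using f(1) g by (auto simp: iso_pair_def retract_pair_def)
qed

text \<open>Here \<open>Y \<cong> Z \<oplus> ker p\<close> and \<open>Z \<oplus> Z \<cong> Z\<close>.\<close>

lemma absorb_square:
  fixes i :: "'z::real_normed_vector \<Rightarrow> 'y::real_normed_vector"
    and \<phi> :: "'z \<times> 'z \<Rightarrow> 'z"
  assumes "retract_pair i p" and "iso_pair \<phi> \<psi>"
  shows "\<exists>f g. iso_pair (f :: 'y \<times> 'z \<Rightarrow> 'y) g"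
proof -
  have i: "bounded_linear i" and p: "bounded_linear p" and pi: "p (i x) = x" for x
    using assms by (auto simp: retract_pair_def)
  have \<phi>: "bounded_linear \<phi>" and \<psi>: "bounded_linear \<psi>" and inv: "\<psi> (\<phi> u) = u" "\<phi> (\<psi> x) = x" for u x
    using assms(2) unfolding retract_pair_def iso_pair_def by blast+
  define a where "a y = y - i (p y)" for y
  have a: "bounded_linear a"
    unfolding a_def by (intro bounded_linear_sub bounded_linear_ident bounded_linear_compose[OF i p])
  \<comment> \<open>\<open>f\<close> keeps the kernel part of the \<open>'y\<close>-component and
    packs its \<open>'z\<close>-part with the second component by \<open>\<phi>\<close>;
    \<open>g\<close> unpacks by \<open>\<psi>\<close>.\<close>
  define f where "f u = a (fst u) + i (\<phi> (p (fst u), snd u))" for u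
  define g where "g y = (a y + i (fst (\<psi> (p y))), snd (\<psi> (p y)))" for y
  have f: "bounded_linear f"
    unfolding f_def
    by (intro bounded_linear_add bounded_linear_compose[OF a] bounded_linear_compose[OF i]
        bounded_linear_compose[OF \<phi>] bounded_linear_Pair bounded_linear_compose[OF p]
        bounded_linear_fst bounded_linear_snd)
  have g: "bounded_linear g"
    unfolding g_def
    by (intro bounded_linear_add bounded_linear_Pair bounded_linear_compose[OF i] a
        bounded_linear_compose[OF bounded_linear_fst] bounded_linear_compose[OF bounded_linear_snd]
        bounded_linear_compose[OF \<psi> p])
  have pa: "p (a y) = 0" and aa: "a (a y) = a y" and ai: "a (i x) = 0"
    and sum: "a y + i (p y) = y" for x y
    by (simp_all add: a_def linear_simps[OF p] linear_simps[OF i] pi)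
  have "g (f u) = u" for u
    by (cases u) (simp add: f_def g_def pa aa ai sum pi inv linear_simps[OF p] linear_simps[OF a])
  moreover have "f (g y) = y" for y
    by (simp add: f_def g_def pa aa ai sum pi inv linear_simps[OF p] linear_simps[OF a])
  ultimately show ?thesis
    using f g by (auto simp: iso_pair_def retract_pair_def)
qed

text \<open>With Z for the space of bounded sequences in Y, the chain is Y ~ Y x Z ~ Z ~ X x Z ~
  X.\<close>

lemma iso_pair_of_retracts:
  fixes i :: "(nat \<Rightarrow>\<^sub>C 'y::real_normed_vector) \<Rightarrow> 'y" and j :: "'y \<Rightarrow> 'x::real_normed_vector"
    and k :: "'x \<Rightarrow> (nat \<Rightarrow>\<^sub>C 'y)"
  assumes i: "retract_pair i p" and j: "retract_pair j q" and k: "retract_pair k r"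
  shows "\<exists>f g. iso_pair (f :: 'y \<Rightarrow> 'x) g"
proof -
  \<comment> \<open>The sequence space absorbs itself, being complemented in
    \<open>'y\<close>.\<close>
  obtain \<phi> \<psi> where sq: "iso_pair (\<phi> :: (nat \<Rightarrow>\<^sub>C 'y) \<times> (nat \<Rightarrow>\<^sub>C 'y) \<Rightarrow> (nat \<Rightarrow>\<^sub>C 'y)) \<psi>"
    using absorb_into_bcontfun[OF i] by blast
  have id: "retract_pair (\<lambda>y::'y. y) (\<lambda>y. y)"
    by (simp add: retract_pair_def bounded_linear_ident)
  obtain f1 g1 where 1: "iso_pair (f1 :: 'y \<times> (nat \<Rightarrow>\<^sub>C 'y) \<Rightarrow> (nat \<Rightarrow>\<^sub>C 'y)) g1"
    using absorb_into_bcontfun[OF id] by blast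
  obtain f2 g2 where 2: "iso_pair (f2 :: 'y \<times> (nat \<Rightarrow>\<^sub>C 'y) \<Rightarrow> 'y) g2"
    using absorb_square[OF i sq] by blast
  \<comment> \<open>\<open>'x\<close> is complemented in \<open>'y\<close> by way of the sequence
    space.\<close>
  obtain f3 g3 where 3: "iso_pair (f3 :: 'x \<times> (nat \<Rightarrow>\<^sub>C 'y) \<Rightarrow> (nat \<Rightarrow>\<^sub>C 'y)) g3"
    using absorb_into_bcontfun[OF retract_pair_trans[OF k i]] by blast
  \<comment> \<open>The sequence space is complemented in \<open>'x\<close> by way of
    \<open>'y\<close>.\<close>
  obtain f4 g4 where 4: "iso_pair (f4 :: 'x \<times> (nat \<Rightarrow>\<^sub>C 'y) \<Rightarrow> 'x) g4"
    using absorb_square[OF retract_pair_trans[OF i j] sq] by blast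
  show ?thesis
    using iso_pair_trans[OF iso_pair_trans[OF iso_pair_sym[OF 2] 1]
        iso_pair_trans[OF iso_pair_sym[OF 3] 4]] by blast
qed

section \<open>Limits along an ultrafilter\<close>

text \<open>Zorn's lemma for the reversed order; minimal proper filters are the ultrafilters. The
  infimum of a nonempty chain is proper because whatever holds eventually for it already does so for
  a member.\<close>

lemma minimal_filter_exists:
  fixes F :: "'a filter"
  assumes "F \<noteq> bot"
  obtains U where "U \<noteq> bot" "U \<le> F" "\<And>V. V \<noteq> bot \<Longrightarrow> V \<le> U \<Longrightarrow> V = U"
proof -
  let ?A = "{U. U \<noteq> bot \<and> U \<le> F}" and ?P = "\<lambda>a b. b \<le> (a :: 'a filter)"
  have "\<exists>m\<in>?A. \<forall>a\<in>?A. ?P m a \<longrightarrow> a = m"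
  proof (rule predicate_Zorn)
    show "partial_order_on ?A (relation_of ?P ?A)"
      by (auto simp: partial_order_on_def preorder_on_def refl_on_def trans_def antisym_def
          relation_of_def)
    fix C assume "C \<in> Chains (relation_of ?P ?A)"
    then have C: "\<forall>a\<in>C. \<forall>b\<in>C. (a \<in> ?A \<and> b \<in> ?A \<and> b \<le> a) \<or> (b \<in> ?A \<and> a \<in> ?A \<and> a \<le> b)"
      by (simp add: Chains_def relation_of_def)
    have sub: "C \<subseteq> ?A" using C by blast
    have lin: "a \<le> b \<or> b \<le> a" if "a \<in> C" "b \<in> C" for a b
      using C that by blast
    show "\<exists>u\<in>?A. \<forall>a\<in>C. ?P a u"
    proof (cases "C = {}")
      case True
      then show ?thesis using assms by auto
    next
      case False
      have "eventually P (Inf C) \<longleftrightarrow> (\<exists>b\<in>C. eventually P b)" for P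
      proof (rule eventually_Inf_base[OF False])
        fix F G assume FG: "F \<in> C" "G \<in> C"
        from lin[OF this] show "\<exists>x\<in>C. x \<le> inf F G"
          by (elim disjE) (use FG in \<open>auto intro: bexI[of _ F] bexI[of _ G]\<close>)
      qed
      then have "Inf C \<noteq> bot"
        using sub by (auto simp: trivial_limit_def)
      moreover have "Inf C \<le> F"
      proof -
        obtain b where "b \<in> C" using False by auto
        with sub have "b \<le> F" by auto
        with \<open>b \<in> C\<close> show ?thesis by (rule Inf_lower2)
      qed
      moreover have "Inf C \<le> a" if "a \<in> C" for a
        using that by (rule Inf_lower)
      ultimately show ?thesis
        by (intro bexI[of _ "Inf C"] ballI CollectI conjI)
    qed
  qed
  then obtain U where "U \<in> ?A" and min: "\<forall>V\<in>?A. V \<le> U \<longrightarrow> V = U" ..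
  then have U: "U \<noteq> bot" "U \<le> F" by simp_all
  show ?thesis
  proof (rule that[OF U])
    fix V assume V: "V \<noteq> bot" "V \<le> U"
    with order_trans[OF V(2) U(2)] show "V = U"
      using min by simp
  qed
qed

text \<open>Compactness gives a cluster point of \<open>b\<close> along \<open>U\<close>. Refining
  \<open>U\<close> by the preimages of its neighbourhoods leaves a proper filter, which equals
  \<open>U\<close> by minimality, so the cluster point is a limit.\<close>

lemma ultrafilter_limits_exist:
  obtains U :: "nat filter" where "U \<noteq> bot" "U \<le> sequentially"
    "\<And>b :: nat \<Rightarrow> real. bounded (range b) \<Longrightarrow> \<exists>l. (b \<longlongrightarrow> l) U"
proof -
  obtain U :: "nat filter" where U: "U \<noteq> bot" "U \<le> sequentially"
    and min: "\<And>V. V \<noteq> bot \<Longrightarrow> V \<le> U \<Longrightarrow> V = U"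
    using minimal_filter_exists[of sequentially] by auto
  have "\<exists>l. (b \<longlongrightarrow> l) U" if "bounded (range b)" for b :: "nat \<Rightarrow> real"
  proof -
    have "compact (closure (range b))"
      using that by (simp add: compact_closure)
    moreover have "filtermap b U \<noteq> bot"
      using U by (simp add: filtermap_bot_iff)
    moreover have "eventually (\<lambda>x. x \<in> closure (range b)) (filtermap b U)"
      using closure_subset[of "range b"] by (auto simp: eventually_filtermap intro!: always_eventually)
    ultimately obtain l where l: "inf (nhds l) (filtermap b U) \<noteq> bot"
      unfolding compact_filter by blast
    have "inf U (filtercomap b (nhds l)) \<noteq> bot"
    proof
      assume "inf U (filtercomap b (nhds l)) = bot"
      then obtain P Q where PQ: "eventually P U" "eventually Q (nhds l)" "\<And>n. P n \<Longrightarrow> \<not> Q (b n)"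
        unfolding trivial_limit_def eventually_inf eventually_filtercomap by metis
      have "eventually (\<lambda>x. \<not> Q x) (filtermap b U)"
        using PQ(1,3) by (auto simp: eventually_filtermap elim: eventually_mono)
      then have "inf (nhds l) (filtermap b U) = bot"
        using PQ(2) unfolding trivial_limit_def eventually_inf by blast
      with l show False by simp
    qed
    then have "U \<le> filtercomap b (nhds l)"
      using min by (metis inf_le1 inf.absorb_iff1)
    then show ?thesis
      by (auto simp: filterlim_iff_le_filtercomap)
  qed
  with U show ?thesis using that by blast
qed

section \<open>Coordinates of grid points\<close>

lemma l1_nth_sum: "l1_nth (\<Sum>i\<in>A. f i) n = (\<Sum>i\<in>A. l1_nth (f i) n)"
  by (induction A rule: infinite_finite_induct) (simp_all add: zero_l1.rep_eq plus_l1.rep_eq)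

lemma sum_abs_l1_nth_le: "finite A \<Longrightarrow> (\<Sum>n\<in>A. \<bar>l1_nth x n\<bar>) \<le> norm x"
  unfolding norm_l1.rep_eq by (intro sum_le_suminf summable_abs_l1_nth) auto

lemma tendsto_l1_nth: "l1_nth x \<longlonglongrightarrow> 0"
  using summable_LIMSEQ_zero[OF summable_abs_l1_nth[of x]] by (simp add: tendsto_rabs_zero_iff)

definition grid_nth :: "l1_grid \<Rightarrow> nat \<Rightarrow> int"
  where "grid_nth x n = \<lfloor>l1_nth (l1_of_grid x) n\<rfloor>"

text \<open>Meaningful only for \<open>a\<close> of finite support; other arguments lie outside the
  domain of the abstraction maps.\<close>

definition grid_of :: "(nat \<Rightarrow> int) \<Rightarrow> l1_grid"
  where "grid_of a = Abs_l1_grid (Abs_l1 (\<lambda>n. of_int (a n)))"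

lemma of_int_grid_nth: "of_int (grid_nth x n) = l1_nth (l1_of_grid x) n"
proof -
  obtain N :: nat and a where "l1_of_grid x = (\<Sum>n<N. of_int (a n) *\<^sub>R l1_basis n)"
    using l1_of_grid[of x] by auto
  then have "l1_nth (l1_of_grid x) n = of_int (\<Sum>k<N. a k * (if n = k then 1 else 0))"
    by (simp add: l1_nth_sum scaleR_l1.rep_eq l1_basis.rep_eq if_distrib cong: if_cong)
  then show ?thesis
    by (simp add: grid_nth_def del: of_int_sum)
qed

lemma grid_eqI: "(\<And>n. grid_nth x n = grid_nth y n) \<Longrightarrow> x = y"
  by (metis l1_eqI of_int_grid_nth l1_of_grid_inject)

text \<open>Coordinates tend to zero, and an integer of modulus below 1 is zero.\<close>

lemma finite_support_grid_nth: "finite {n. grid_nth x n \<noteq> 0}"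
proof -
  have "eventually (\<lambda>n. \<bar>l1_nth (l1_of_grid x) n\<bar> < 1) sequentially"
    using order_tendstoD(2)[OF tendsto_rabs_zero[OF tendsto_l1_nth]] by simp
  then have "eventually (\<lambda>n. grid_nth x n = 0) sequentially"
    by eventually_elim (simp flip: of_int_grid_nth)
  then show ?thesis
    by (simp add: eventually_cofinite flip: cofinite_eq_sequentially)
qed

lemma l1_nth_grid_of:
  assumes "finite {n. a n \<noteq> 0}"
  shows "l1_nth (l1_of_grid (grid_of a)) n = of_int (a n)"
proof -
  have abs: "l1_nth (Abs_l1 (\<lambda>n. of_int (a n))) = (\<lambda>n. of_int (a n))"
    by (rule Abs_l1_inverse) (use assms in \<open>auto intro!: summable_finite[of "{n. a n \<noteq> 0}"]\<close>)
  obtain N where N: "\<And>n. a n \<noteq> 0 \<Longrightarrow> n < N"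
    using finite_nat_bounded[OF assms] by auto
  have "Abs_l1 (\<lambda>n. of_int (a n)) = (\<Sum>n<N. of_int (a n) *\<^sub>R l1_basis n)"
  proof (rule l1_eqI)
    fix n
    show "l1_nth (Abs_l1 (\<lambda>n. of_int (a n))) n = l1_nth (\<Sum>n<N. of_int (a n) *\<^sub>R l1_basis n) n"
      using N[of n]
      by (auto simp: abs l1_nth_sum scaleR_l1.rep_eq l1_basis.rep_eq if_distrib cong: if_cong)
  qed
  then have "l1_of_grid (grid_of a) = Abs_l1 (\<lambda>n. of_int (a n))"
    unfolding grid_of_def by (intro Abs_l1_grid_inverse) auto
  then show ?thesis by (simp add: abs)
qed

lemma grid_nth_grid_of: "finite {n. a n \<noteq> 0} \<Longrightarrow> grid_nth (grid_of a) n = a n"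
  by (simp add: grid_nth_def l1_nth_grid_of)

lemma grid_nth_0 [simp]: "grid_nth 0 n = 0"
  by (simp add: grid_nth_def zero_l1_grid.rep_eq zero_l1.rep_eq)

lemma dist_grid: "dist x y = norm (l1_of_grid x - l1_of_grid y)"
  by (simp add: dist_l1_grid_def dist_norm)

lemma l1_nth_diff_grid:
  "l1_nth (l1_of_grid x - l1_of_grid y) n = of_int (grid_nth x n - grid_nth y n)"
  by (simp add: minus_l1.rep_eq flip: of_int_grid_nth)

lemma summable_grid_nth_diff: "summable (\<lambda>n. \<bar>of_int (grid_nth x n - grid_nth y n) :: real\<bar>)"
  using summable_abs_l1_nth[of "l1_of_grid x - l1_of_grid y"] by (simp only: l1_nth_diff_grid)

lemma dist_grid_suminf: "dist x y = (\<Sum>n. \<bar>of_int (grid_nth x n - grid_nth y n)\<bar>)"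
  by (simp only: dist_grid norm_l1.rep_eq l1_nth_diff_grid)

lemma sum_grid_nth_le_dist:
  "finite A \<Longrightarrow> (\<Sum>n\<in>A. \<bar>of_int (grid_nth x n - grid_nth y n)\<bar>) \<le> dist x y"
  using sum_abs_l1_nth_le[of A "l1_of_grid x - l1_of_grid y"]
  by (simp only: dist_grid l1_nth_diff_grid)

lemma dist_grid_leI:
  assumes "\<And>N. (\<Sum>n<N. \<bar>of_int (grid_nth x n - grid_nth y n)\<bar>) \<le> B"
  shows "dist x y \<le> B"
  unfolding dist_grid by (rule norm_l1_leI) (simp only: l1_nth_diff_grid assms)

section \<open>Operators into spaces of Lipschitz functions\<close>

lemma lip0_diff_le: "\<bar>lip0_apply f x - lip0_apply f y\<bar> \<le> norm f * dist x y"
  using lipschitz_onD[OF lipschitz_on_norm_lip0[of f], of x y] by (simp add: dist_real_def)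

lemma bounded_linear_into_lip0:
  fixes T :: "'e::real_normed_vector \<Rightarrow> 'm::{metric_space,zero} \<Rightarrow> real"
  assumes "\<And>v. T v 0 = 0"
    and add: "\<And>v w x. T (v + w) x = T v x + T w x"
    and scale: "\<And>c v x. T (c *\<^sub>R v) x = c * T v x"
    and lip: "\<And>v x y. \<bar>T v x - T v y\<bar> \<le> norm v * dist x y"
  shows "\<exists>S. bounded_linear S \<and> (\<forall>v x. lip0_apply (S v) x = T v x) \<and> (\<forall>v. norm (S v) \<le> norm v)"
proof (intro exI conjI allI)
  define S where "S v = Abs_lip0 (T v)" for v
  have L: "(norm v)-lipschitz_on UNIV (T v)" for v
    by (rule lipschitz_onI) (auto simp: dist_real_def lip)
  have app: "lip0_apply (S v) = T v" for v
    unfolding S_def by (rule Abs_lip0_inverse) (use assms(1) L in auto)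
  then show "lip0_apply (S v) x = T v x" for v x by simp
  show "norm (S v) \<le> norm v" for v
    by (rule norm_lip0_le) (simp add: app L)
  then show "bounded_linear S"
    by (intro bounded_linear_intro[where K = 1])
      (auto intro!: lip0_eqI simp: app plus_lip0.rep_eq scaleR_lip0.rep_eq add scale)
qed

section \<open>Splitting the grid into infinitely many copies of itself\<close>

text \<open>Block \<open>k\<close> consists of the coordinates \<open>prod_encode (k, j)\<close>.
  \<open>grid_embed k\<close> places a copy of the grid there, and \<open>grid_proj k\<close> reads
  it back.\<close>

definition grid_embed :: "nat \<Rightarrow> l1_grid \<Rightarrow> l1_grid"
  where "grid_embed k x =
    grid_of (\<lambda>n. if fst (prod_decode n) = k then grid_nth x (snd (prod_decode n)) else 0)"

definition grid_proj :: "nat \<Rightarrow> l1_grid \<Rightarrow> l1_grid"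
  where "grid_proj k x = grid_of (\<lambda>j. grid_nth x (prod_encode (k, j)))"

lemma grid_nth_embed:
  "grid_nth (grid_embed k x) n =
    (if fst (prod_decode n) = k then grid_nth x (snd (prod_decode n)) else 0)"
proof -
  have "finite ((\<lambda>j. prod_encode (k, j)) ` {j. grid_nth x j \<noteq> 0})"
    by (intro finite_imageI finite_support_grid_nth)
  then have "finite {n. (if fst (prod_decode n) = k then grid_nth x (snd (prod_decode n)) else 0) \<noteq> 0}"
    by (rule finite_subset[rotated])
      (auto split: if_splits intro!: rev_image_eqI)
  then show ?thesis
    unfolding grid_embed_def by (rule grid_nth_grid_of)
qed

lemma inj_prod_encode_Pair: "inj (\<lambda>j. prod_encode (k, j))"
  by (auto intro: injI)

lemma grid_nth_proj: "grid_nth (grid_proj k x) j = grid_nth x (prod_encode (k, j))"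
proof -
  have "finite ((\<lambda>j. prod_encode (k, j)) -` {n. grid_nth x n \<noteq> 0})"
    by (intro finite_vimageI finite_support_grid_nth inj_prod_encode_Pair)
  then show ?thesis
    unfolding grid_proj_def by (intro grid_nth_grid_of) (simp add: vimage_def)
qed

lemma grid_proj_0 [simp]: "grid_proj k 0 = 0"
  by (rule grid_eqI) (simp add: grid_nth_proj)

lemma grid_embed_0 [simp]: "grid_embed k 0 = 0"
  by (rule grid_eqI) (simp add: grid_nth_embed)

lemma grid_proj_embed: "grid_proj k (grid_embed l x) = (if k = l then x else 0)"
  by (rule grid_eqI) (simp add: grid_nth_embed grid_nth_proj)

lemma dist_grid_embed_le: "dist (grid_embed k x) (grid_embed k y) \<le> dist x y"
proof (rule dist_grid_leI)
  fix N
  let ?A = "{n. n < N \<and> fst (prod_decode n) = k}"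
  have inj: "inj_on (\<lambda>n. snd (prod_decode n)) ?A"
    by (rule inj_onI) (metis (mono_tags, lifting) mem_Collect_eq prod.collapse prod_decode_inverse)
  have "(\<Sum>n<N. \<bar>of_int (grid_nth (grid_embed k x) n - grid_nth (grid_embed k y) n) :: real\<bar>)
      = (\<Sum>n\<in>?A. \<bar>of_int (grid_nth x (snd (prod_decode n)) - grid_nth y (snd (prod_decode n)))\<bar>)"
    by (rule sum.mono_neutral_cong_right) (auto simp: grid_nth_embed)
  also have "\<dots> = (\<Sum>j\<in>(\<lambda>n. snd (prod_decode n)) ` ?A. \<bar>of_int (grid_nth x j - grid_nth y j)\<bar>)"
    by (simp only: sum.reindex[OF inj] o_def)
  also have "\<dots> \<le> dist x y"
    by (rule sum_grid_nth_le_dist) auto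
  finally show "(\<Sum>n<N. \<bar>of_int (grid_nth (grid_embed k x) n - grid_nth (grid_embed k y) n)\<bar>) \<le> dist x y" .
qed

text \<open>Blocks are disjoint, so cutting each at \<open>J\<close> leaves a sum over finitely many
  distinct coordinates; then \<open>J\<close> tends to infinity.\<close>

lemma sum_dist_grid_proj_le: "(\<Sum>k<K. dist (grid_proj k x) (grid_proj k y)) \<le> dist x y"
proof -
  let ?d = "\<lambda>k j. \<bar>of_int (grid_nth (grid_proj k x) j - grid_nth (grid_proj k y) j) :: real\<bar>"
  have "(\<lambda>J. \<Sum>k<K. \<Sum>j<J. ?d k j) \<longlonglongrightarrow> (\<Sum>k<K. dist (grid_proj k x) (grid_proj k y))"
    unfolding dist_grid_suminf
    by (intro tendsto_sum summable_LIMSEQ summable_grid_nth_diff)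
  then show ?thesis
  proof (rule LIMSEQ_le_const2, intro exI allI impI)
    fix J
    have "(\<Sum>k<K. \<Sum>j<J. ?d k j) = (\<Sum>z\<in>{..<K} \<times> {..<J}.
        \<bar>of_int (grid_nth x (prod_encode z) - grid_nth y (prod_encode z))\<bar>)"
      by (simp add: grid_nth_proj sum.cartesian_product case_prod_unfold)
    also have "\<dots> = (\<Sum>n\<in>prod_encode ` ({..<K} \<times> {..<J}). \<bar>of_int (grid_nth x n - grid_nth y n)\<bar>)"
      by (subst sum.reindex[OF inj_prod_encode]) simp
    also have "\<dots> \<le> dist x y"
      by (rule sum_grid_nth_le_dist) auto
    finally show "(\<Sum>k<K. \<Sum>j<J. ?d k j) \<le> dist x y" .
  qed
qed

lemma linfty_retract_of_lip0_grid:
  "\<exists>i p. retract_pair (i :: (nat \<Rightarrow>\<^sub>C l1_grid lip0) \<Rightarrow> l1_grid lip0) p"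
proof -
  let ?t = "\<lambda>F x k. lip0_apply (apply_bcontfun F k) (grid_proj k x)"
  have le: "\<bar>?t F x k - ?t F y k\<bar> \<le> norm F * dist (grid_proj k x) (grid_proj k y)" for F x y k
    by (rule order_trans[OF lip0_diff_le]) (intro mult_right_mono norm_bounded zero_le_dist)
  have sd: "summable (\<lambda>k. dist (grid_proj k x) (grid_proj k y))" for x y
    by (rule bounded_imp_summable[where B = "dist x y"])
      (simp_all add: sum_dist_grid_proj_le flip: lessThan_Suc_atMost del: sum.lessThan_Suc)
  \<comment> \<open>Comparison with the base point, where every term vanishes.\<close>
  have st: "summable (?t F x)" for F x
    by (rule summable_comparison_test'[OF summable_mult[OF sd[of x 0], of "norm F"]])
      (use le[where F = F and x = x and y = 0] in \<open>simp add: lip0_apply_0\<close>)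
  have "\<exists>i. bounded_linear i \<and> (\<forall>F x. lip0_apply (i F) x = (\<Sum>k. ?t F x k)) \<and>
      (\<forall>F. norm (i F) \<le> norm F)"
  proof (rule bounded_linear_into_lip0[of "\<lambda>F x. \<Sum>k. ?t F x k"])
    fix F :: "nat \<Rightarrow>\<^sub>C l1_grid lip0" and x y :: l1_grid
    have "summable (\<lambda>k. \<bar>?t F x k - ?t F y k\<bar>)"
      by (rule summable_comparison_test'[OF summable_mult[OF sd[of x y], of "norm F"]])
        (use le[where F = F and x = x and y = y] in simp)
    then have "\<bar>\<Sum>k. ?t F x k - ?t F y k\<bar> \<le> (\<Sum>k. norm F * dist (grid_proj k x) (grid_proj k y))"
      by (intro order_trans[OF summable_rabs] suminf_le le summable_mult sd)
    also have "\<dots> = norm F * (\<Sum>k. dist (grid_proj k x) (grid_proj k y))"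
      by (rule suminf_mult[OF sd])
    also have "\<dots> \<le> norm F * dist x y"
      by (intro mult_left_mono suminf_le_const sd sum_dist_grid_proj_le) auto
    finally show "\<bar>(\<Sum>k. ?t F x k) - (\<Sum>k. ?t F y k)\<bar> \<le> norm F * dist x y"
      by (simp add: suminf_diff st)
  qed (simp_all add: lip0_apply_0 plus_lip0.rep_eq scaleR_lip0.rep_eq suminf_add st
      suminf_mult[OF st])
  then obtain i where i: "bounded_linear i" "\<And>F x. lip0_apply (i F) x = (\<Sum>k. ?t F x k)"
    by blast
  have lip: "\<bar>lip0_apply f (grid_embed k x) - lip0_apply f (grid_embed k y)\<bar> \<le> norm f * dist x y"
    for f k x y
    by (rule order_trans[OF lip0_diff_le]) (intro mult_left_mono dist_grid_embed_le norm_ge_zero)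
  have "\<exists>q :: l1_grid lip0 \<Rightarrow> l1_grid lip0. bounded_linear q \<and>
      (\<forall>f x. lip0_apply (q f) x = lip0_apply f (grid_embed k x)) \<and> (\<forall>f. norm (q f) \<le> norm f)" for k
    by (rule bounded_linear_into_lip0[of "\<lambda>f x. lip0_apply f (grid_embed k x)"])
      (auto simp: lip0_apply_0 plus_lip0.rep_eq scaleR_lip0.rep_eq lip)
  then obtain q :: "nat \<Rightarrow> l1_grid lip0 \<Rightarrow> l1_grid lip0" where q: "\<And>k. bounded_linear (q k)"
    "\<And>k f x. lip0_apply (q k f) x = lip0_apply f (grid_embed k x)"
    "\<And>k f. norm (q k f) \<le> norm f"
    by metis
  obtain p where p: "bounded_linear p" "\<And>f k. apply_bcontfun (p f) k = q k f"
    using bounded_linear_into_bcontfun[of q 1] q by auto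
  have "p (i F) = F" for F
  proof (intro bcontfun_eqI lip0_eqI)
    fix k x
    have "lip0_apply (apply_bcontfun (p (i F)) k) x = (\<Sum>l. ?t F (grid_embed k x) l)"
      by (simp add: p q i)
    \<comment> \<open>For \<open>l\<close> other than \<open>k\<close> the function is evaluated at
      the base point.\<close>
    also have "\<dots> = (\<Sum>l\<in>{k}. ?t F (grid_embed k x) l)"
      by (rule suminf_finite) (auto simp: grid_proj_embed lip0_apply_0)
    finally show "lip0_apply (apply_bcontfun (p (i F)) k) x = lip0_apply (apply_bcontfun F k) x"
      by (simp add: grid_proj_embed)
  qed
  then show ?thesis
    using i p by (auto simp: retract_pair_def)
qed

section \<open>Rounding to finer and finer grids\<close>

definition grid_round :: "l1 \<Rightarrow> l1_grid"
  where "grid_round x = grid_of (\<lambda>n. round (l1_nth x n))"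

text \<open>Coordinates are eventually below 1/2 in modulus and round to 0, so the support is
  finite.\<close>

lemma grid_nth_round: "grid_nth (grid_round x) n = round (l1_nth x n)"
proof -
  have "eventually (\<lambda>n. \<bar>l1_nth x n\<bar> < 1/2) sequentially"
    using order_tendstoD(2)[OF tendsto_rabs_zero[OF tendsto_l1_nth[of x]], of "1/2"] by simp
  then have "eventually (\<lambda>n. round (l1_nth x n) = 0) sequentially"
    by eventually_elim (auto intro: round_unique')
  then have "finite {n. round (l1_nth x n) \<noteq> 0}"
    by (simp add: eventually_cofinite flip: cofinite_eq_sequentially)
  then show ?thesis
    unfolding grid_round_def by (rule grid_nth_grid_of)
qed

lemma grid_nth_round_of_nat_scaleR:
  "grid_nth (grid_round (real m *\<^sub>R l1_of_grid x)) k = int m * grid_nth x k"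
proof -
  have "real m * l1_nth (l1_of_grid x) k = of_int (int m * grid_nth x k)"
    by (simp add: of_int_grid_nth)
  then show ?thesis
    by (simp only: grid_nth_round scaleR_l1.rep_eq round_of_int)
qed

text \<open>The first bound yields coordinatewise convergence. The second, which holds because 0
  competes as nearest integer, yields a summable majorant free of \<open>c\<close>.\<close>

lemma round_scaled_error:
  fixes c t :: real
  assumes "c > 0"
  shows "\<bar>of_int (round (c * t)) / c - t\<bar> \<le> inverse c" "\<bar>of_int (round (c * t)) / c - t\<bar> \<le> \<bar>t\<bar>"
proof -
  have eq: "\<bar>of_int (round (c * t)) / c - t\<bar> = \<bar>of_int (round (c * t)) - c * t\<bar> / c"
  proof -
    have "of_int (round (c * t)) / c - t = (of_int (round (c * t)) - c * t) / c"
      using assms by (simp add: field_simps)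
    with assms show ?thesis
      by (simp only: abs_divide abs_of_pos)
  qed
  have "\<bar>of_int (round (c * t)) - c * t\<bar> \<le> 1"
    using of_int_round_abs_le[of "c * t"] by linarith
  with assms show "\<bar>of_int (round (c * t)) / c - t\<bar> \<le> inverse c"
    unfolding eq by (simp add: divide_simps)
  have "\<bar>of_int (round (c * t)) - c * t\<bar> \<le> c * \<bar>t\<bar>"
    using round_diff_minimal[of "c * t" 0] assms by (simp add: abs_mult abs_minus_commute)
  with assms show "\<bar>of_int (round (c * t)) / c - t\<bar> \<le> \<bar>t\<bar>"
    unfolding eq by (simp add: divide_le_eq mult.commute)
qed

definition grid_approx :: "nat \<Rightarrow> l1 \<Rightarrow> l1"
  where "grid_approx n x = (1 / real (Suc n)) *\<^sub>R l1_of_grid (grid_round (real (Suc n) *\<^sub>R x))"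

lemma l1_nth_grid_approx:
  "l1_nth (grid_approx n x) k = of_int (round (real (Suc n) * l1_nth x k)) / real (Suc n)"
  by (simp only: grid_approx_def scaleR_l1.rep_eq grid_nth_round mult_1_left times_divide_eq_left
      flip: of_int_grid_nth)

text \<open>Dominated convergence for series (Tannery), with majorant
  \<open>\<bar>l1_nth x k\<bar>\<close>.\<close>

lemma tendsto_grid_approx: "(\<lambda>n. grid_approx n x) \<longlonglongrightarrow> x"
proof -
  define e where "e k n = \<bar>of_int (round (real (Suc n) * l1_nth x k)) / real (Suc n) - l1_nth x k\<bar>" for k n
  have e0: "0 \<le> e k n" and e1: "e k n \<le> inverse (real (Suc n))" and e2: "e k n \<le> \<bar>l1_nth x k\<bar>" for k n
    unfolding e_def by (rule abs_ge_zero round_scaled_error of_nat_0_less_iff[THEN iffD2] zero_less_Suc)+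
  have lim0: "e k \<longlonglongrightarrow> 0" for k
    by (rule tendsto_sandwich[OF always_eventually always_eventually tendsto_const
          LIMSEQ_inverse_real_of_nat]) (rule allI e0 e1)+
  have "(\<lambda>n. \<Sum>k. e k n) \<longlonglongrightarrow> (\<Sum>k. 0)"
  proof (rule tannerys_theorem[THEN conjunct2, THEN conjunct2])
    show "eventually (\<lambda>(k, n). norm (e k n) \<le> \<bar>l1_nth x k\<bar>) (sequentially \<times>\<^sub>F sequentially)"
      using e0 e2 by (intro always_eventually) simp
  qed (rule lim0 summable_abs_l1_nth sequentially_bot)+
  moreover have "(\<Sum>k. e k n) = norm (grid_approx n x - x)" for n
    by (simp only: norm_l1.rep_eq e_def minus_l1.rep_eq l1_nth_grid_approx)
  ultimately have "(\<lambda>n. norm (grid_approx n x - x)) \<longlonglongrightarrow> 0"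
    by simp
  then show ?thesis
    by (simp only: tendsto_norm_zero_iff LIM_zero_iff)
qed

lemma dist_grid_round_scaled:
  "dist (grid_round (real (Suc n) *\<^sub>R x)) (grid_round (real (Suc n) *\<^sub>R y)) / real (Suc n) =
    norm (grid_approx n x - grid_approx n y)"
  by (simp add: grid_approx_def dist_grid flip: scaleR_diff_right)

lemma grid_round_0 [simp]: "grid_round 0 = 0"
  by (rule grid_eqI) (simp add: grid_nth_round zero_l1.rep_eq)

text \<open>The choice of the ultrafilter stays hidden: the values of \<open>p F\<close> are only needed at points where
  the sequence converges outright.\<close>

lemma reconstruct_lip0_l1:
  "\<exists>p :: (nat \<Rightarrow>\<^sub>C l1_grid lip0) \<Rightarrow> l1 lip0. bounded_linear p \<and>
    (\<forall>F x l. (\<lambda>n. lip0_apply (apply_bcontfun F n) (grid_round (real (Suc n) *\<^sub>R x)) / real (Suc n))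
      \<longlonglongrightarrow> l \<longrightarrow> lip0_apply (p F) x = l)"
proof -
  obtain U :: "nat filter" where U: "U \<noteq> bot" "U \<le> sequentially"
    "\<And>b :: nat \<Rightarrow> real. bounded (range b) \<Longrightarrow> \<exists>l. (b \<longlongrightarrow> l) U"
    using ultrafilter_limits_exist by blast
  define s where "s F x n = lip0_apply (apply_bcontfun F n) (grid_round (real (Suc n) *\<^sub>R x)) / real (Suc n)"
    for F :: "nat \<Rightarrow>\<^sub>C l1_grid lip0" and x n
  have s_diff: "\<bar>s F x n - s F y n\<bar> \<le> norm F * norm (grid_approx n x - grid_approx n y)" for F x y n
  proof -
    let ?R = "\<lambda>x. grid_round (real (Suc n) *\<^sub>R x)"
    have "\<bar>lip0_apply (apply_bcontfun F n) (?R x) - lip0_apply (apply_bcontfun F n) (?R y)\<bar>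
        \<le> norm F * dist (?R x) (?R y)"
      by (rule order_trans[OF lip0_diff_le]) (intro mult_right_mono norm_bounded zero_le_dist)
    then have "\<bar>lip0_apply (apply_bcontfun F n) (?R x) - lip0_apply (apply_bcontfun F n) (?R y)\<bar> / real (Suc n)
        \<le> norm F * dist (?R x) (?R y) / real (Suc n)"
      by (rule divide_right_mono) simp
    then show ?thesis
      unfolding s_def times_divide_eq_right[symmetric] dist_grid_round_scaled
      by (simp only: abs_divide abs_of_nat flip: diff_divide_distrib)
  qed
  have s0: "s F 0 = (\<lambda>_. 0)" for F
    by (simp add: s_def lip0_apply_0 fun_eq_iff)
  have r0: "grid_approx n 0 = 0" for n
    by (simp add: grid_approx_def zero_l1_grid.rep_eq)
  have "bounded (range (s F x))" for F x
  proof -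
    obtain B where B: "norm (grid_approx n x) \<le> B" for n
      using convergentI[OF tendsto_grid_approx[of x], THEN convergent_imp_Bseq]
      by (auto simp: Bseq_def)
    have "\<bar>s F x n\<bar> \<le> norm F * B" for n
      using s_diff[of F x n 0] mult_left_mono[OF B[of n] norm_ge_zero[of F]] by (simp add: s0 r0)
    then show ?thesis
      by (auto simp: bounded_iff)
  qed
  then have "\<exists>l. (s F x \<longlongrightarrow> l) U" for F x
    using U(3) by blast
  then obtain T where T: "(s F x \<longlongrightarrow> T F x) U" for F x
    by metis
  \<comment> \<open>Limits along the proper filter \<open>U\<close> are unique, which makes
    \<open>T\<close> linear.\<close>
  have uniq: "T F x = l" if "(s F x \<longlongrightarrow> l) U" for F x l
    using tendsto_unique[OF U(1) T that] .
  have "\<exists>p. bounded_linear p \<and> (\<forall>F x. lip0_apply (p F) x = T F x) \<and> (\<forall>F. norm (p F) \<le> norm F)"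
  proof (rule bounded_linear_into_lip0[of T])
    fix F G x y and c :: real
    show "T F 0 = 0"
      by (rule uniq) (simp only: s0 tendsto_const)
    have "s (F + G) x = (\<lambda>n. s F x n + s G x n)"
      by (auto simp: s_def plus_lip0.rep_eq add_divide_distrib)
    then show "T (F + G) x = T F x + T G x"
      by (intro uniq) (auto intro: tendsto_add T)
    have "s (c *\<^sub>R F) x = (\<lambda>n. c * s F x n)"
      by (auto simp: s_def scaleR_lip0.rep_eq)
    then show "T (c *\<^sub>R F) x = c * T F x"
      by (intro uniq) (auto intro: tendsto_mult_left T)
    \<comment> \<open>Rounding may enlarge distances at a fixed scale, but the rounded distances
      converge to \<open>dist x y\<close>.\<close>
    show "\<bar>T F x - T F y\<bar> \<le> norm F * dist x y"
    proof (rule tendsto_le[OF U(1)])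
      show "((\<lambda>n. \<bar>s F x n - s F y n\<bar>) \<longlongrightarrow> \<bar>T F x - T F y\<bar>) U"
        by (intro tendsto_intros T)
      show "((\<lambda>n. norm F * norm (grid_approx n x - grid_approx n y)) \<longlongrightarrow> norm F * dist x y) U"
        unfolding dist_norm
        by (rule tendsto_mono[OF U(2)]) (intro tendsto_intros tendsto_grid_approx)
    qed (simp add: s_diff)
  qed
  then obtain p where p: "bounded_linear p" "\<And>F x. lip0_apply (p F) x = T F x"
    by blast
  show ?thesis
  proof (intro exI[of _ p] conjI allI impI p(1))
    fix F x l
    assume "(\<lambda>n. lip0_apply (apply_bcontfun F n) (grid_round (real (Suc n) *\<^sub>R x)) / real (Suc n)) \<longlonglongrightarrow> l"
    then have "(s F x \<longlongrightarrow> l) U"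
      unfolding s_def by (rule tendsto_mono[OF U(2)])
    then show "lip0_apply (p F) x = l"
      by (simp add: p uniq)
  qed
qed

lemma lip0_l1_retract_of_linfty:
  "\<exists>k r. retract_pair (k :: l1 lip0 \<Rightarrow> (nat \<Rightarrow>\<^sub>C l1_grid lip0)) r"
proof -
  let ?t = "\<lambda>n f y. real (Suc n) * lip0_apply f ((1 / real (Suc n)) *\<^sub>R l1_of_grid y)"
  have "\<exists>q. bounded_linear q \<and> (\<forall>f y. lip0_apply (q f) y = ?t n f y) \<and> (\<forall>f. norm (q f) \<le> norm f)" for n
  proof (rule bounded_linear_into_lip0[of "?t n"])
    fix f :: "l1 lip0" and x y
    let ?s = "\<lambda>y. (1 / real (Suc n)) *\<^sub>R l1_of_grid y"
    have scale: "dist (?s x) (?s y) = dist x y / real (Suc n)"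
      by (simp add: dist_norm dist_grid del: of_nat_Suc flip: scaleR_diff_right)
    have "\<bar>?t n f x - ?t n f y\<bar> = real (Suc n) * \<bar>lip0_apply f (?s x) - lip0_apply f (?s y)\<bar>"
      by (simp only: abs_mult abs_of_nat flip: right_diff_distrib)
    also have "\<dots> \<le> real (Suc n) * (norm f * dist (?s x) (?s y))"
      by (intro mult_left_mono lip0_diff_le) simp
    also have "\<dots> = norm f * dist x y"
      unfolding scale by (simp del: of_nat_Suc)
    finally show "\<bar>?t n f x - ?t n f y\<bar> \<le> norm f * dist x y" .
  qed (simp_all add: lip0_apply_0 plus_lip0.rep_eq scaleR_lip0.rep_eq zero_l1_grid.rep_eq
      distrib_left del: of_nat_Suc)
  then obtain q :: "nat \<Rightarrow> l1 lip0 \<Rightarrow> l1_grid lip0" where q: "\<And>n. bounded_linear (q n)"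
    "\<And>n f y. lip0_apply (q n f) y = ?t n f y" "\<And>n f. norm (q n f) \<le> norm f"
    by metis
  obtain k where k: "bounded_linear k" "\<And>f n. apply_bcontfun (k f) n = q n f"
    using bounded_linear_into_bcontfun[of q 1] q by auto
  obtain p :: "(nat \<Rightarrow>\<^sub>C l1_grid lip0) \<Rightarrow> l1 lip0" where p: "bounded_linear p"
    "\<And>F x l. (\<lambda>n. lip0_apply (apply_bcontfun F n) (grid_round (real (Suc n) *\<^sub>R x)) / real (Suc n))
      \<longlonglongrightarrow> l \<Longrightarrow> lip0_apply (p F) x = l"
    using reconstruct_lip0_l1 by blast
  have "p (k f) = f" for f
  proof (intro lip0_eqI p(2))
    fix x
    have cont: "isCont (lip0_apply f) x"
      using lipschitz_on_continuous_on[OF lipschitz_on_norm_lip0[of f]]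
      by (simp add: continuous_on_eq_continuous_at)
    \<comment> \<open>The terms are the values of \<open>f\<close> at
      \<open>grid_approx n x\<close>, so continuity gives an ordinary limit.\<close>
    show "(\<lambda>n. lip0_apply (apply_bcontfun (k f) n) (grid_round (real (Suc n) *\<^sub>R x)) / real (Suc n))
        \<longlonglongrightarrow> lip0_apply f x"
      using isCont_tendsto_compose[OF cont tendsto_grid_approx]
      by (simp add: k q grid_approx_def del: of_nat_Suc)
  qed
  with k p show ?thesis
    by (auto simp: retract_pair_def)
qed

section \<open>Extension from the grid to \<open>\<ell>\<^sub>1\<close>\<close>

text \<open>Hermite's identity. Raising \<open>a\<close> by 1 telescopes the sum and raises it by 1;
  at \<open>a = 0\<close> all quotients vanish.\<close>

lemma sum_div_shift:
  assumes "m > 0"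
  shows "(\<Sum>j<m. (a + int j) div int m) = a"
proof -
  have step: "(\<Sum>j<m. (b + 1 + int j) div int m) = (\<Sum>j<m. (b + int j) div int m) + 1" for b
  proof -
    have "(\<Sum>j<m. (b + 1 + int j) div int m) - (\<Sum>j<m. (b + int j) div int m) =
        (\<Sum>j<m. (b + int (Suc j)) div int m - (b + int j) div int m)"
      by (simp add: sum_subtractf algebra_simps)
    also have "\<dots> = (b + int m) div int m - b div int m"
      by (subst sum_lessThan_telescope) simp
    finally show ?thesis using assms by simp
  qed
  show ?thesis
  proof (induction a rule: int_induct[where k = 0])
    case base
    show ?case by (simp add: div_pos_pos_trivial)
  next
    case (step1 i)
    with step[of i] show ?case by simp
  next
    case (step2 i)
    with step[of "i - 1"] show ?case by simp
  qed
qed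

text \<open>Division by \<open>m\<close> is monotone, so all differences have the same sign.\<close>

lemma sum_abs_div_shift:
  assumes "m > 0"
  shows "(\<Sum>j<m. \<bar>(a + int j) div int m - (b + int j) div int m\<bar>) = \<bar>a - b\<bar>"
proof (induction b a rule: linorder_wlog)
  case (le b a)
  have "(\<Sum>j<m. \<bar>(a + int j) div int m - (b + int j) div int m\<bar>)
      = (\<Sum>j<m. (a + int j) div int m - (b + int j) div int m)"
    using le assms by (intro sum.cong abs_of_nonneg) (auto intro: zdiv_mono1)
  with le assms show ?case
    by (simp add: sum_subtractf sum_div_shift)
next
  case (sym b a)
  then show ?case by (simp add: abs_minus_commute)
qed

text \<open>Averaging \<open>f \<circ> grid_div m j\<close> over \<open>j < m\<close> gives the interpolation of \<open>f\<close> on \<open>1/m\<close> times the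
  grid, with the argument scaled by \<open>m\<close>.\<close>

definition grid_div :: "nat \<Rightarrow> nat \<Rightarrow> l1_grid \<Rightarrow> l1_grid"
  where "grid_div m j x = grid_of (\<lambda>n. (grid_nth x n + int j) div int m)"

text \<open>For \<open>j < m\<close> zero coordinates stay zero, so the support remains
  finite.\<close>

lemma grid_nth_div: "j < m \<Longrightarrow> grid_nth (grid_div m j x) n = (grid_nth x n + int j) div int m"
  unfolding grid_div_def
  by (rule grid_nth_grid_of, rule finite_subset[OF _ finite_support_grid_nth[of x]])
    (auto simp: div_pos_pos_trivial)

lemma grid_div_0 [simp]: "j < m \<Longrightarrow> grid_div m j 0 = 0"
  by (rule grid_eqI) (simp add: grid_nth_div div_pos_pos_trivial)

text \<open>Interchanging the sums reduces this to \<open>sum_abs_div_shift\<close> in each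
  coordinate.\<close>

lemma sum_dist_grid_div:
  assumes "m > 0"
  shows "(\<Sum>j<m. dist (grid_div m j x) (grid_div m j y)) = dist x y"
proof -
  have "(\<Sum>j<m. dist (grid_div m j x) (grid_div m j y)) =
      (\<Sum>n. \<Sum>j<m. \<bar>of_int (grid_nth (grid_div m j x) n - grid_nth (grid_div m j y) n)\<bar>)"
    unfolding dist_grid_suminf by (rule suminf_sum[symmetric, OF summable_grid_nth_diff])
  also have "\<dots> = (\<Sum>n. of_int (\<Sum>j<m. \<bar>(grid_nth x n + int j) div int m - (grid_nth y n + int j) div int m\<bar>))"
    by (simp add: grid_nth_div)
  also have "\<dots> = dist x y"
    unfolding sum_abs_div_shift[OF assms] dist_grid_suminf by simp
  finally show ?thesis .
qed

lemma lip0_grid_retract_of_lip0_l1: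
  "\<exists>j q. retract_pair (j :: l1_grid lip0 \<Rightarrow> l1 lip0) q"
proof -
  \<comment> \<open>The averaging factor \<open>1 / Suc n\<close> is supplied later by the division
    in \<open>reconstruct_lip0_l1\<close>.\<close>
  let ?t = "\<lambda>n f z. \<Sum>j<Suc n. lip0_apply f (grid_div (Suc n) j z)"
  have "\<exists>a :: l1_grid lip0 \<Rightarrow> l1_grid lip0. bounded_linear a \<and>
      (\<forall>f z. lip0_apply (a f) z = ?t n f z) \<and> (\<forall>f. norm (a f) \<le> norm f)" for n
  proof (rule bounded_linear_into_lip0[of "?t n"])
    fix f :: "l1_grid lip0" and x y
    have "\<bar>?t n f x - ?t n f y\<bar> \<le> (\<Sum>j<Suc n. \<bar>lip0_apply f (grid_div (Suc n) j x) - lip0_apply f (grid_div (Suc n) j y)\<bar>)"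
      by (simp only: sum_abs flip: sum_subtractf)
    also have "\<dots> \<le> (\<Sum>j<Suc n. norm f * dist (grid_div (Suc n) j x) (grid_div (Suc n) j y))"
      by (intro sum_mono lip0_diff_le)
    also have "\<dots> = norm f * dist x y"
      by (simp only: sum_dist_grid_div[OF zero_less_Suc] flip: sum_distrib_left)
    finally show "\<bar>?t n f x - ?t n f y\<bar> \<le> norm f * dist x y" .
  next
    fix f g :: "l1_grid lip0" and x and c :: real
    show "?t n (f + g) x = ?t n f x + ?t n g x"
      by (simp only: plus_lip0.rep_eq sum.distrib)
    show "?t n (c *\<^sub>R f) x = c * ?t n f x"
      by (simp only: scaleR_lip0.rep_eq sum_distrib_left)
  qed (simp add: lip0_apply_0)
  then obtain a :: "nat \<Rightarrow> l1_grid lip0 \<Rightarrow> l1_grid lip0" where a: "\<And>n. bounded_linear (a n)"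
    "\<And>n f z. lip0_apply (a n f) z = ?t n f z" "\<And>n f. norm (a n f) \<le> norm f"
    by metis
  obtain k where k: "bounded_linear k" "\<And>f n. apply_bcontfun (k f) n = a n f"
    using bounded_linear_into_bcontfun[of a 1] a by auto
  obtain p :: "(nat \<Rightarrow>\<^sub>C l1_grid lip0) \<Rightarrow> l1 lip0" where p: "bounded_linear p"
    "\<And>F x l. (\<lambda>n. lip0_apply (apply_bcontfun F n) (grid_round (real (Suc n) *\<^sub>R x)) / real (Suc n))
      \<longlonglongrightarrow> l \<Longrightarrow> lip0_apply (p F) x = l"
    using reconstruct_lip0_l1 by blast
  have "\<exists>q :: l1 lip0 \<Rightarrow> l1_grid lip0. bounded_linear q \<and>
      (\<forall>f z. lip0_apply (q f) z = lip0_apply f (l1_of_grid z)) \<and> (\<forall>f. norm (q f) \<le> norm f)"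
    by (rule bounded_linear_into_lip0[of "\<lambda>f z. lip0_apply f (l1_of_grid z)"])
      (auto simp: zero_l1_grid.rep_eq lip0_apply_0 plus_lip0.rep_eq scaleR_lip0.rep_eq
        dist_l1_grid_def lip0_diff_le)
  then obtain q :: "l1 lip0 \<Rightarrow> l1_grid lip0" where q: "bounded_linear q"
    "\<And>f z. lip0_apply (q f) z = lip0_apply f (l1_of_grid z)"
    by blast
  \<comment> \<open>On multiples of \<open>Suc n\<close> a shift by \<open>j < Suc n\<close> does
    not change the quotient. Hence the interpolation agrees with \<open>f\<close> at grid points,
    and the sequence to be reconstructed is constant there.\<close>
  have div: "grid_div (Suc n) j (grid_round (real (Suc n) *\<^sub>R l1_of_grid z)) = z" if "j < Suc n" for n j z
  proof (rule grid_eqI)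
    fix i
    have "grid_nth (grid_round (real (Suc n) *\<^sub>R l1_of_grid z)) i = int (Suc n) * grid_nth z i"
      by (rule grid_nth_round_of_nat_scaleR)
    with that show "grid_nth (grid_div (Suc n) j (grid_round (real (Suc n) *\<^sub>R l1_of_grid z))) i = grid_nth z i"
      by (simp add: grid_nth_div div_pos_pos_trivial del: of_nat_Suc)
  qed
  have "q (p (k f)) = f" for f
  proof (rule lip0_eqI)
    fix z
    have "lip0_apply (a n f) (grid_round (real (Suc n) *\<^sub>R l1_of_grid z)) / real (Suc n) = lip0_apply f z" for n
    proof -
      have "lip0_apply (a n f) (grid_round (real (Suc n) *\<^sub>R l1_of_grid z)) = (\<Sum>j<Suc n. lip0_apply f z)"
        unfolding a by (intro sum.cong refl) (simp only: div lessThan_iff)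
      then show ?thesis by (simp del: of_nat_Suc sum.lessThan_Suc)
    qed
    then have "lip0_apply (p (k f)) (l1_of_grid z) = lip0_apply f z"
      by (intro p(2)) (simp only: k tendsto_const)
    then show "lip0_apply (q (p (k f))) z = lip0_apply f z"
      by (simp add: q)
  qed
  then show ?thesis
    unfolding retract_pair_def
    using bounded_linear_compose[OF p(1) k(1)] q(1) by blast
qed

theorem theorem3p9:
  shows "\<exists>T :: l1_grid lip0 \<Rightarrow> l1 lip0. bounded_linear T \<and> bij T \<and> bounded_linear (inv T)"
proof -
  obtain f g where fg: "iso_pair (f :: l1_grid lip0 \<Rightarrow> l1 lip0) g"
    using iso_pair_of_retracts linfty_retract_of_lip0_grid lip0_grid_retract_of_lip0_l1
      lip0_l1_retract_of_linfty by metis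
  then have "inv f = g"
    by (intro inv_unique_comp) (auto simp: iso_pair_def retract_pair_def)
  moreover have "bij f"
    using fg by (intro o_bij[of g f]) (auto simp: iso_pair_def retract_pair_def)
  ultimately show ?thesis
    using fg by (auto simp: iso_pair_def retract_pair_def)
qed

end
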